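(* A dynamical system characterized by two variables $\{q,p\}$ follows Hamilton's equations if and only if its displacement field $S=\{\frac{dq}{dt},\frac{dp}{dt}\}$ is divergenceless.
   Context: The displacement field $S=\{S^q,S^p\}=\{\frac{dq}{dt},\frac{dp}{dt}\}$ is the vector field on the two-dimensional space of states, charted by the variables $(q,p)$, that gives the direction in which each state moves over time. The system follows Hamilton's equations if there is a function $H$ (the Hamiltonian) such that $\frac{dq}{dt}=\frac{\partial H}{\partial p}$ and $\frac{dp}{dt}=-\frac{\partial H}{\partial q}$. $S$ is divergenceless if $\frac{\partial S^q}{\partial q}+\frac{\partial S^p}{\partial p}=0$. The Hamiltonian $H$ is assumed to be twice differentiable.
   Formalization: The space of states is taken to be an open simply connected region of the (q,p)-plane (e.g. the whole plane) and S to be differentiable; on the punctured plane S=(q,p)/(q²+p²) is divergenceless but has no global Hamiltonian. *)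

theory Defs
  imports "HOL-Analysis.Analysis"
begin

text \<open>A state is the pair \<open>(q, p)\<close> of its coordinates, so the state space is a subset \<open>M\<close> of the
  plane, and the displacement field \<open>S\<close> sends \<open>(q, p)\<close> to \<open>(S\<^sup>q, S\<^sup>p) = (dq/dt, dp/dt)\<close>.\<close>

definition partial_q :: "(real \<times> real \<Rightarrow> real) \<Rightarrow> real \<times> real \<Rightarrow> real" where
  "partial_q f = (\<lambda>(q, p). deriv (\<lambda>x. f (x, p)) q)"

definition partial_p :: "(real \<times> real \<Rightarrow> real) \<Rightarrow> real \<times> real \<Rightarrow> real" where
  "partial_p f = (\<lambda>(q, p). deriv (\<lambda>y. f (q, y)) p)"

text \<open>Twice differentiable in the Frechet sense; continuity of the second derivative is not
  required. The set is meant to be open, so that \<open>at x\<close> and \<open>at x within A\<close> agree on it.\<close>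

definition twice_differentiable_on ::
    "('a::real_normed_vector \<Rightarrow> 'b::real_normed_vector) \<Rightarrow> 'a set \<Rightarrow> bool" where
  "twice_differentiable_on f A \<longleftrightarrow>
     (\<exists>f' :: 'a \<Rightarrow> 'a \<Rightarrow>\<^sub>L 'b.
        (\<forall>x\<in>A. (f has_derivative blinfun_apply (f' x)) (at x)) \<and> f' differentiable_on A)"

definition follows_hamilton_equations ::
    "(real \<times> real) set \<Rightarrow> (real \<times> real \<Rightarrow> real \<times> real) \<Rightarrow> bool" where
  "follows_hamilton_equations M S \<longleftrightarrow>
     (\<exists>H :: real \<times> real \<Rightarrow> real. twice_differentiable_on H M \<and>
        (\<forall>z\<in>M. fst (S z) = partial_p H z \<and> snd (S z) = - partial_q H z))"

text \<open>\<open>deriv\<close> is a total function, so the following is meaningful only for fields whose partial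
  derivatives exist, in particular for differentiable ones.\<close>

definition divergenceless ::
    "(real \<times> real) set \<Rightarrow> (real \<times> real \<Rightarrow> real \<times> real) \<Rightarrow> bool" where
  "divergenceless M S \<longleftrightarrow>
     (\<forall>z\<in>M. partial_q (\<lambda>w. fst (S w)) z + partial_p (\<lambda>w. snd (S w)) z = 0)"

end

theory Submission
  imports Defs "HOL-Complex_Analysis.Riemann_Mapping"
begin

text \<open>Hamilton's equations say \<open>dH = \<omega>\<close> for the 1-form \<open>\<omega> = S\<^sup>q dp - S\<^sup>p dq\<close>, and \<open>S\<close> is
  divergenceless iff the Frechet derivative of \<open>\<omega>\<close> is symmetric at every point, i.e. iff \<open>\<omega>\<close> is closed.
  Exact forms are closed by the symmetry of second derivatives.  For the converse, \<open>\<omega>\<close> is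
  differentiable but its derivative need not be continuous, so differentiation under the integral sign
  and Green's theorem are not available; instead, Goursat's bisection argument shows that a closed form
  has vanishing integral over every triangle, which gives a primitive on convex open sets.  The Riemann
  mapping theorem carries this over to simply connected open sets of the plane, because closedness and
  exactness are preserved by pullback along twice differentiable maps.\<close>

subsection \<open>Integrals of 1-forms over segments and triangles\<close>

text \<open>A 1-form is encoded as a map into the bounded linear maps. Its derivative
  \<open>A\<close> at a point is then the curried bilinear map \<open>A u v\<close>, with
  \<open>u\<close> the direction of differentiation and \<open>v\<close> the argument of the
  form.\<close>

definition line_integral ::
    "('a::real_normed_vector \<Rightarrow> 'a \<Rightarrow>\<^sub>L 'b::real_normed_vector) \<Rightarrow> 'a \<Rightarrow> 'a \<Rightarrow> 'b" where
  "line_integral \<omega> a b = integral {0..1} (\<lambda>t. blinfun_apply (\<omega> (linepath a b t)) (b - a))"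

definition triangle_integral ::
    "('a::real_normed_vector \<Rightarrow> 'a \<Rightarrow>\<^sub>L 'b::real_normed_vector) \<Rightarrow> 'a \<Rightarrow> 'a \<Rightarrow> 'a \<Rightarrow> 'b" where
  "triangle_integral \<omega> a b c = line_integral \<omega> a b + line_integral \<omega> b c + line_integral \<omega> c a"

section \<open>Segment integrals computed from antiderivatives\<close>

lemma line_integral_FTC:
  fixes \<omega> :: "'a::real_normed_vector \<Rightarrow> 'a \<Rightarrow>\<^sub>L 'b::banach"
  assumes "\<And>t. t \<in> {0..1} \<Longrightarrow>
    (\<Phi> has_vector_derivative \<omega> (linepath a b t) (b - a)) (at t within {0..1})"
  shows "line_integral \<omega> a b = \<Phi> 1 - \<Phi> 0"
  unfolding line_integral_def
  by (rule integral_unique, rule fundamental_theorem_of_calculus) (use assms in auto)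

lemma continuous_on_line_integrand:
  fixes \<omega> :: "'a::real_normed_vector \<Rightarrow> 'a \<Rightarrow>\<^sub>L 'b::real_normed_vector"
  assumes "continuous_on (closed_segment a b) \<omega>"
  shows "continuous_on {0..1} (\<lambda>t. \<omega> (linepath a b t) (b - a))"
proof -
  have "continuous_on {0..1} (\<lambda>t. \<omega> (linepath a b t))"
    by (rule continuous_on_compose2[OF assms])
      (auto simp: linepath_in_path continuous_on_linepath)
  then show ?thesis by (intro continuous_intros)
qed

lemma line_integral_antiderivative:
  fixes \<omega> :: "'a::real_normed_vector \<Rightarrow> 'a \<Rightarrow>\<^sub>L 'b::banach"
  assumes "continuous_on (closed_segment a b) \<omega>"
  obtains \<Phi> where "\<And>t. t \<in> {0..1} \<Longrightarrow>
    (\<Phi> has_vector_derivative \<omega> (linepath a b t) (b - a)) (at t within {0..1})"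
  using antiderivative_continuous[OF continuous_on_line_integrand[OF assms]] by blast

lemma line_integral_exact:
  fixes \<omega> :: "'a::real_normed_vector \<Rightarrow> 'a \<Rightarrow>\<^sub>L 'b::banach"
  assumes "\<And>z. z \<in> closed_segment a b \<Longrightarrow> (H has_derivative \<omega> z) (at z)"
  shows "line_integral \<omega> a b = H b - H a"
proof -
  have "line_integral \<omega> a b = (H \<circ> linepath a b) 1 - (H \<circ> linepath a b) 0"
  proof (rule line_integral_FTC)
    fix t :: real assume "t \<in> {0..1}"
    then have H: "(H has_derivative \<omega> (linepath a b t)) (at (linepath a b t))"
      using assms linepath_in_path by blast
    show "((H \<circ> linepath a b) has_vector_derivative \<omega> (linepath a b t) (b - a)) (at t within {0..1})"
      using vector_derivative_diff_chain_within[OF has_vector_derivative_linepath_within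
          has_derivative_at_withinI[OF H]] .
  qed
  then show ?thesis by (simp add: linepath_0' linepath_1')
qed

text \<open>An antiderivative \<open>\<Phi>\<close> along the whole segment, composed with the
  affine map from \<open>s\<close> to \<open>r\<close>, is one along the subsegment. As
  \<open>r < s\<close> is allowed, this covers reversal as well as bisection.\<close>

lemma line_integral_affine_subpath:
  fixes \<omega> :: "'a::real_normed_vector \<Rightarrow> 'a \<Rightarrow>\<^sub>L 'b::banach"
  assumes \<Phi>: "\<And>t. t \<in> {0..1} \<Longrightarrow>
      (\<Phi> has_vector_derivative \<omega> (linepath a b t) (b - a)) (at t within {0..1})"
    and k: "0 \<le> s" "s \<le> 1" "0 \<le> r" "r \<le> 1"
  shows "line_integral \<omega> (linepath a b s) (linepath a b r) = \<Phi> r - \<Phi> s"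
proof -
  let ?g = "\<lambda>t. s + (r - s) * t"
  have "line_integral \<omega> (linepath a b s) (linepath a b r) = (\<Phi> \<circ> ?g) 1 - (\<Phi> \<circ> ?g) 0"
  proof (rule line_integral_FTC)
    fix t :: real assume t: "t \<in> {0..1}"
    have g01: "?g u \<in> {0..1}" if "u \<in> {0..1}" for u
    proof -
      have "?g u = (1 - u) * s + u * r" by (simp add: algebra_simps)
      moreover have "(1 - u) * s + u * r \<le> 1"
        using that k by (intro convex_bound_le) auto
      ultimately show ?thesis using that k by auto
    qed
    have g: "(?g has_vector_derivative (r - s)) (at t within {0..1})"
      by (auto intro!: derivative_eq_intros simp: has_real_derivative_iff_has_vector_derivative[symmetric])
    have "(\<Phi> has_vector_derivative \<omega> (linepath a b (?g t)) (b - a)) (at (?g t) within ?g ` {0..1})"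
      by (rule has_vector_derivative_within_subset[OF \<Phi>[OF g01[OF t]]]) (use g01 in blast)
    from vector_diff_chain_within[OF g this]
    have "((\<Phi> \<circ> ?g) has_vector_derivative (r - s) *\<^sub>R \<omega> (linepath a b (?g t)) (b - a))
        (at t within {0..1})" .
    moreover have "linepath (linepath a b s) (linepath a b r) t = linepath a b (?g t)"
      by (simp add: linepath_def algebra_simps)
    moreover have "linepath a b r - linepath a b s = (r - s) *\<^sub>R (b - a)"
      by (simp add: linepath_def algebra_simps)
    ultimately show "((\<Phi> \<circ> ?g) has_vector_derivative
        \<omega> (linepath (linepath a b s) (linepath a b r) t) (linepath a b r - linepath a b s))
        (at t within {0..1})"
      by (simp add: blinfun.scaleR_right)
  qed
  then show ?thesis by simp
qed

lemma line_integral_reverse: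
  fixes \<omega> :: "'a::real_normed_vector \<Rightarrow> 'a \<Rightarrow>\<^sub>L 'b::banach"
  assumes "continuous_on (closed_segment a b) \<omega>"
  shows "line_integral \<omega> b a = - line_integral \<omega> a b"
proof -
  obtain \<Phi> where \<Phi>: "\<And>t. t \<in> {0..1} \<Longrightarrow>
      (\<Phi> has_vector_derivative \<omega> (linepath a b t) (b - a)) (at t within {0..1})"
    using line_integral_antiderivative[OF assms] by blast
  from line_integral_affine_subpath[OF \<Phi>, of 0 1] line_integral_affine_subpath[OF \<Phi>, of 1 0]
  show ?thesis by (simp add: linepath_0' linepath_1')
qed

lemma line_integral_midpoint:
  fixes \<omega> :: "'a::real_normed_vector \<Rightarrow> 'a \<Rightarrow>\<^sub>L 'b::banach"
  assumes "continuous_on (closed_segment a b) \<omega>"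
  shows "line_integral \<omega> a b = line_integral \<omega> a (midpoint a b) + line_integral \<omega> (midpoint a b) b"
proof -
  obtain \<Phi> where \<Phi>: "\<And>t. t \<in> {0..1} \<Longrightarrow>
      (\<Phi> has_vector_derivative \<omega> (linepath a b t) (b - a)) (at t within {0..1})"
    using line_integral_antiderivative[OF assms] by blast
  have "linepath a b (1/2) = midpoint a b"
    by (simp add: linepath_def midpoint_def scaleR_add_right)
  with line_integral_affine_subpath[OF \<Phi>, of 0 1] line_integral_affine_subpath[OF \<Phi>, of 0 "1/2"]
    line_integral_affine_subpath[OF \<Phi>, of "1/2" 1]
  show ?thesis by (simp add: linepath_0' linepath_1')
qed

text \<open>The affine form \<open>\<omega> x + A (z - x)\<close> integrates exactly to the
  subtracted term, where 1/2 is the integral of \<open>t\<close> over the unit interval; the rest of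
  the form has norm at most \<open>e\<close> on the segment. With \<open>A\<close> the derivative
  this serves Goursat's argument, with \<open>A = 0\<close> the construction of primitives.\<close>

lemma line_integral_linearization:
  fixes \<omega> :: "'a::real_normed_vector \<Rightarrow> 'a \<Rightarrow>\<^sub>L 'b::banach"
  assumes cont: "continuous_on (closed_segment a b) \<omega>"
    and A: "bounded_linear A"
    and e: "\<And>z. z \<in> closed_segment a b \<Longrightarrow> norm (\<omega> z - \<omega> x - A (z - x)) \<le> e"
  shows "norm (line_integral \<omega> a b -
      (\<omega> x (b - a) + A (a - x) (b - a) + (1/2) *\<^sub>R A (b - a) (b - a))) \<le> e * norm (b - a)"
proof -
  interpret A: bounded_linear A by fact
  let ?h = "\<lambda>t. \<omega> (linepath a b t) (b - a)"
  let ?k = "\<lambda>t. \<omega> x (b - a) + A (a - x) (b - a) + t *\<^sub>R A (b - a) (b - a)"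
  let ?\<psi> = "\<lambda>t::real. t *\<^sub>R (\<omega> x (b - a) + A (a - x) (b - a)) + (t^2/2) *\<^sub>R A (b - a) (b - a)"
  have h: "(?h has_integral line_integral \<omega> a b) {0..1}"
    unfolding line_integral_def
    by (intro integrable_integral integrable_continuous_real continuous_on_line_integrand cont)
  have k: "(?k has_integral (?\<psi> 1 - ?\<psi> 0)) {0..1}"
    by (rule fundamental_theorem_of_calculus)
      (auto intro!: derivative_eq_intros simp: has_vector_derivative_def algebra_simps)
  have "norm (line_integral \<omega> a b - (?\<psi> 1 - ?\<psi> 0)) \<le> (e * norm (b - a)) * measure lborel (cbox 0 (1::real))"
  proof (rule has_integral_bound)
    have "0 \<le> e" using e[of a] norm_ge_zero order_trans ends_in_segment(1) by blast
    then show "0 \<le> e * norm (b - a)" by simp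
    show "((\<lambda>t. ?h t - ?k t) has_integral (line_integral \<omega> a b - (?\<psi> 1 - ?\<psi> 0))) (cbox 0 1)"
      using has_integral_diff[OF h k] by simp
    fix t :: real assume "t \<in> cbox 0 1"
    then have z: "linepath a b t \<in> closed_segment a b" by (simp add: linepath_in_path)
    have "linepath a b t - x = (a - x) + t *\<^sub>R (b - a)" by (simp add: linepath_def algebra_simps)
    then have "A (linepath a b t - x) = A (a - x) + t *\<^sub>R A (b - a)"
      by (simp only: A.add A.scaleR)
    then have "?h t - ?k t = (\<omega> (linepath a b t) - \<omega> x - A (linepath a b t - x)) (b - a)"
      by (simp add: blinfun.diff_left blinfun.add_left blinfun.scaleR_left)
    also have "norm \<dots> \<le> norm (\<omega> (linepath a b t) - \<omega> x - A (linepath a b t - x)) * norm (b - a)"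
      by (rule norm_blinfun)
    also have "\<dots> \<le> e * norm (b - a)" by (intro mult_right_mono e z) auto
    finally show "norm (?h t - ?k t) \<le> e * norm (b - a)" .
  qed
  then show ?thesis by simp
qed

text \<open>Stokes' formula for an affine form: the constant part cancels, since the sides sum to
  zero, and the linear part leaves half the antisymmetric part of \<open>A\<close> on the two sides
  at \<open>a\<close>.\<close>

lemma triangle_integral_linearization:
  fixes \<omega> :: "'a::real_normed_vector \<Rightarrow> 'a \<Rightarrow>\<^sub>L 'b::banach"
  assumes cont: "continuous_on (convex hull {a, b, c}) \<omega>"
    and A: "bounded_linear A"
    and e: "\<And>z. z \<in> convex hull {a, b, c} \<Longrightarrow> norm (\<omega> z - \<omega> x - A (z - x)) \<le> e"
  shows "norm (triangle_integral \<omega> a b c -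
      (1/2) *\<^sub>R (A (b - a) (c - a) - A (c - a) (b - a)))
    \<le> e * (norm (b - a) + norm (c - b) + norm (a - c))"
proof -
  interpret A: bounded_linear A by fact
  let ?L = "\<lambda>a b. \<omega> x (b - a) + A (a - x) (b - a) + (1/2) *\<^sub>R A (b - a) (b - a)"
  have sub: "closed_segment a b \<subseteq> convex hull {a, b, c}"
    "closed_segment b c \<subseteq> convex hull {a, b, c}" "closed_segment c a \<subseteq> convex hull {a, b, c}"
    by (rule segments_subset_convex_hull)+
  have est: "norm (line_integral \<omega> p q - ?L p q) \<le> e * norm (q - p)"
    if "closed_segment p q \<subseteq> convex hull {a, b, c}" for p q
    by (rule line_integral_linearization[OF continuous_on_subset[OF cont that] A]) (use e that in auto)
  have quad: "?L a b + ?L b c + ?L c a = (1/2) *\<^sub>R (A (b - a) (c - a) - A (c - a) (b - a))"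
  proof -
    define u v w where "u = b - a" "v = c - a" "w = a - x"
    then have "b = a + u" "c = a + v" "a = x + w" by auto
    then have *: "b - a = u" "c - b = v - u" "a - c = - v" "a - x = w" "b - x = w + u" "c - x = w + v"
      "c - a = v"
      by auto
    \<comment> \<open>Writing each value of \<open>A\<close> as twice its half reduces the identity
      to sums and differences without scalar factors.\<close>
    define P Q R T where "P = (1/2) *\<^sub>R A u u" "Q = (1/2) *\<^sub>R A u v"
      "R = (1/2) *\<^sub>R A v u" "T = (1/2) *\<^sub>R A v v"
    have half: "A u u = P + P" "A u v = Q + Q" "A v u = R + R" "A v v = T + T"
      unfolding P_Q_R_T_def by (simp_all flip: scaleR_add_left)
    have double: "(1/2) *\<^sub>R (y + y) = y" for y :: 'b by (rule scaleR_half_double)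
    have "?L a b = \<omega> x u + A w u + P"
      unfolding * half double ..
    moreover have "?L b c = \<omega> x v - \<omega> x u + A w v - A w u + (Q + Q) - (P + P) + (T - R - Q + P)"
    proof -
      have "A (v - u) (v - u) = (T - R - Q + P) + (T - R - Q + P)"
        by (simp add: A.diff blinfun.diff_left blinfun.diff_right half)
      then show ?thesis unfolding *
        by (simp only: double) (simp add: A.add blinfun.add_left blinfun.diff_right half)
    qed
    moreover have "?L c a = - \<omega> x v - A w v - (T + T) + T"
    proof -
      have "A (- v) (- v) = T + T"
        by (simp add: A.neg blinfun.minus_left blinfun.minus_right half)
      then show ?thesis unfolding *
        by (simp only: double) (simp add: A.add blinfun.add_left blinfun.minus_right half)
    qed
    moreover have "(1/2) *\<^sub>R (A u v - A v u) = Q - R"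
      unfolding P_Q_R_T_def by (rule scaleR_diff_right)
    ultimately show ?thesis unfolding * by simp
  qed
  have "triangle_integral \<omega> a b c - (1/2) *\<^sub>R (A (b - a) (c - a) - A (c - a) (b - a)) =
      (line_integral \<omega> a b - ?L a b) + (line_integral \<omega> b c - ?L b c) + (line_integral \<omega> c a - ?L c a)"
    unfolding quad[symmetric] triangle_integral_def by (simp add: algebra_simps)
  also have "norm \<dots> \<le> e * norm (b - a) + e * norm (c - b) + e * norm (a - c)"
    by (intro norm_triangle_mono est sub)
  finally show ?thesis by (simp add: algebra_simps)
qed

subsection \<open>Closed and exact forms\<close>

lemma has_derivative_at_estimate:
  assumes "(f has_derivative D) (at x)" "e > 0"
  obtains d where "d > 0" "\<And>z. norm (z - x) < d \<Longrightarrow> norm (f z - f x - D (z - x)) \<le> e * norm (z - x)"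
  using assms unfolding has_derivative_at_alt by blast

text \<open>The integral of the exact form \<open>\<omega>\<close> over the triangle \<open>x, x + t u, x + t v\<close> is \<open>0\<close>, but by
  linearization it is \<open>t\<^sup>2/2 (A u v - A v u) + o(t\<^sup>2)\<close>.\<close>

lemma symmetric_second_derivative:
  fixes H :: "'a::real_normed_vector \<Rightarrow> 'b::banach" and \<omega> :: "'a \<Rightarrow> 'a \<Rightarrow>\<^sub>L 'b"
  assumes "open M" "x \<in> M" and H: "\<And>z. z \<in> M \<Longrightarrow> (H has_derivative \<omega> z) (at z)"
    and cont: "continuous_on M \<omega>" and A: "(\<omega> has_derivative A) (at x)"
  shows "A u v = A v u"
proof -
  \<comment> \<open>As \<open>m\<close> exceeds \<open>norm u + norm v\<close>, the triangle
    \<open>x\<close>, \<open>x + t u\<close>, \<open>x + t v\<close> lies within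
    \<open>t * m\<close> of \<open>x\<close>; the summand 1 covers \<open>u = v = 0\<close>.\<close>
  define m where "m = norm u + norm v + 1"
  have m: "m > 0" unfolding m_def using norm_ge_zero[of u] norm_ge_zero[of v] by linarith
  interpret A: bounded_linear A using A by (rule has_derivative_bounded_linear)
  \<comment> \<open>The remainder is at most \<open>\<epsilon> * t * m\<close> on the triangle,
    whose perimeter is at most \<open>2 * t * m\<close>; dividing by \<open>t\<^sup>2 / 2\<close>
    gives the factor 4.\<close>
  have small: "norm (A u v - A v u) \<le> 4 * \<epsilon> * m\<^sup>2" if eps: "\<epsilon> > 0" for \<epsilon>
  proof -
    obtain d where d: "d > 0"
      "\<And>z. norm (z - x) < d \<Longrightarrow> norm (\<omega> z - \<omega> x - A (z - x)) \<le> \<epsilon> * norm (z - x)"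
      using has_derivative_at_estimate[OF A eps] by metis
    obtain r where r: "r > 0" "ball x r \<subseteq> M" using \<open>open M\<close> \<open>x \<in> M\<close> openE by blast
    define t where "t = min d r / (2 * m)"
    have t: "t > 0" "t * m < d" "t * m < r" unfolding t_def using m d(1) r(1) by (auto simp: field_simps min_def)
    let ?b = "x + t *\<^sub>R u" and ?c = "x + t *\<^sub>R v"
    let ?D = "convex hull {x, ?b, ?c}"
    have "?D \<subseteq> cball x (t * m)"
      by (rule hull_minimal) (use t m in \<open>auto simp: dist_norm m_def algebra_simps\<close>)
    then have D: "norm (z - x) \<le> t * m" if "z \<in> ?D" for z
      using that by (auto simp: dist_norm norm_minus_commute)
    then have DM: "?D \<subseteq> M" using r(2) t(3) by (force simp: dist_norm norm_minus_commute)
    have exact: "line_integral \<omega> p q = H q - H p" if "closed_segment p q \<subseteq> ?D" for p q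
      by (rule line_integral_exact) (use H DM that in auto)
    have zero: "triangle_integral \<omega> x ?b ?c = 0"
      unfolding triangle_integral_def
      by (simp add: exact segments_subset_convex_hull)
    have est: "norm (triangle_integral \<omega> x ?b ?c -
        (1/2) *\<^sub>R (A (?b - x) (?c - x) - A (?c - x) (?b - x)))
      \<le> (\<epsilon> * (t * m)) * (norm (?b - x) + norm (?c - ?b) + norm (x - ?c))"
    proof (rule triangle_integral_linearization)
      show "continuous_on ?D \<omega>" using cont DM continuous_on_subset by blast
      fix z assume z: "z \<in> ?D"
      have "norm (\<omega> z - \<omega> x - A (z - x)) \<le> \<epsilon> * norm (z - x)"
        using d(2) D[OF z] t(2) by fastforce
      also have "\<dots> \<le> \<epsilon> * (t * m)" using D[OF z] eps by simp
      finally show "norm (\<omega> z - \<omega> x - A (z - x)) \<le> \<epsilon> * (t * m)" .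
    qed (rule A.bounded_linear_axioms)
    have bilinear: "(1/2) *\<^sub>R (A (?b - x) (?c - x) - A (?c - x) (?b - x)) = (t\<^sup>2 / 2) *\<^sub>R (A u v - A v u)"
      by (simp add: A.scaleR blinfun.scaleR_left blinfun.scaleR_right power2_eq_square scaleR_diff_right)
    have sides: "norm (?b - x) + norm (?c - ?b) + norm (x - ?c) \<le> 2 * (t * m)"
    proof -
      have "norm (?c - ?b) \<le> norm (t *\<^sub>R v) + norm (t *\<^sub>R u)"
        using norm_triangle_ineq4[of "t *\<^sub>R v" "t *\<^sub>R u"] by simp
      then show ?thesis using t(1) by (simp add: m_def algebra_simps)
    qed
    have "norm ((t\<^sup>2 / 2) *\<^sub>R (A u v - A v u)) \<le>
        (\<epsilon> * (t * m)) * (norm (?b - x) + norm (?c - ?b) + norm (x - ?c))"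
      using est unfolding zero bilinear diff_0 norm_minus_cancel .
    also have "\<dots> \<le> (\<epsilon> * (t * m)) * (2 * (t * m))"
      by (intro mult_left_mono sides) (use eps t(1) m in auto)
    finally have "norm ((t\<^sup>2 / 2) *\<^sub>R (A u v - A v u)) \<le> (\<epsilon> * (t * m)) * (2 * (t * m))" .
    moreover have "norm ((t\<^sup>2 / 2) *\<^sub>R (A u v - A v u)) = t\<^sup>2 / 2 * norm (A u v - A v u)"
      by (simp only: norm_scaleR) simp
    ultimately have "t\<^sup>2 * norm (A u v - A v u) \<le> t\<^sup>2 * (4 * \<epsilon> * m\<^sup>2)"
      by (simp add: power2_eq_square algebra_simps)
    then show ?thesis using t(1) by simp
  qed
  have "norm (A u v - A v u) \<le> 0 + \<eta>" if "\<eta> > 0" for \<eta>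
    using small[of "\<eta> / (4 * m\<^sup>2)"] that m by simp
  then have "norm (A u v - A v u) \<le> 0" using field_le_epsilon by blast
  then show ?thesis by simp
qed

text \<open>The antisymmetric part of \<open>A\<close> is the exterior derivative, so symmetry means
  that it vanishes. The derivative is taken in a full neighbourhood even where \<open>M\<close> is
  not open, so the notion applies to closed triangles.\<close>

definition closed_form_on ::
    "('a::real_normed_vector \<Rightarrow> 'a \<Rightarrow>\<^sub>L 'b::real_normed_vector) \<Rightarrow> 'a set \<Rightarrow> bool" where
  "closed_form_on \<omega> M \<longleftrightarrow>
    (\<forall>x\<in>M. \<exists>A. (\<omega> has_derivative A) (at x) \<and> (\<forall>u v. A u v = A v u))"

definition exact_form_on ::
    "('a::real_normed_vector \<Rightarrow> 'a \<Rightarrow>\<^sub>L 'b::real_normed_vector) \<Rightarrow> 'a set \<Rightarrow> bool" where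
  "exact_form_on \<omega> M \<longleftrightarrow> (\<exists>H. \<forall>x\<in>M. (H has_derivative \<omega> x) (at x))"

lemma closed_form_on_subset: "closed_form_on \<omega> M \<Longrightarrow> N \<subseteq> M \<Longrightarrow> closed_form_on \<omega> N"
  unfolding closed_form_on_def by blast

lemma closed_form_on_imp_continuous_on: "closed_form_on \<omega> M \<Longrightarrow> continuous_on M \<omega>"
  unfolding closed_form_on_def
  by (meson continuous_at_imp_continuous_on has_derivative_continuous)

section \<open>Goursat's bisection and primitives on convex sets\<close>

definition perimeter :: "'a::real_normed_vector \<Rightarrow> 'a \<Rightarrow> 'a \<Rightarrow> real" where
  "perimeter a b c = norm (b - a) + norm (c - b) + norm (a - c)"

text \<open>The diameter of a triangle is attained at two vertices, so halving perimeters also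
  shrinks diameters.\<close>

lemma norm_diff_le_perimeter:
  fixes a b c :: "'a::euclidean_space"
  assumes "x \<in> convex hull {a, b, c}" "y \<in> convex hull {a, b, c}"
  shows "norm (x - y) \<le> perimeter a b c"
proof -
  have *: "norm (p - q) \<le> perimeter a b c" if "p \<in> {a, b, c}" "q \<in> {a, b, c}" for p q
    using that unfolding perimeter_def by (auto simp: norm_minus_commute)
  obtain p q where "p \<in> {a, b, c}" "q \<in> {a, b, c}" "norm (x - y) \<le> norm (p - q)"
    using simplex_extremal_le[of "{a, b, c}"] assms by (metis finite.intros insert_not_empty)
  with * show ?thesis using order_trans by blast
qed

text \<open>The midpoints cut the triangle into four copies of half the size. Equally oriented, they
  run through the inner edges in opposite directions, so their integrals add up to the given one and
  some copy carries at least a quarter of its norm.\<close>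

lemma triangle_integral_subdivide:
  fixes \<omega> :: "'a::real_normed_vector \<Rightarrow> 'a \<Rightarrow>\<^sub>L 'b::banach"
  assumes "continuous_on (convex hull {a, b, c}) \<omega>"
  obtains a' b' c' where "convex hull {a', b', c'} \<subseteq> convex hull {a, b, c}"
    "perimeter a' b' c' = perimeter a b c / 2"
    "norm (triangle_integral \<omega> a b c) \<le> 4 * norm (triangle_integral \<omega> a' b' c')"
proof -
  let ?D = "convex hull {a, b, c}"
  define p q r where "p = midpoint b c" "q = midpoint c a" "r = midpoint a b"
  note mid = p_q_r_def
  have mem: "a \<in> ?D" "b \<in> ?D" "c \<in> ?D" by (auto intro: hull_inc)
  have mem': "p \<in> ?D" "q \<in> ?D" "r \<in> ?D"
    unfolding mid by (intro midpoints_in_convex_hull mem)+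
  have cont: "continuous_on (closed_segment u v) \<omega>" if "u \<in> ?D" "v \<in> ?D" for u v
    using assms continuous_on_subset closed_segment_subset[OF that convex_convex_hull] by blast
  have sub: "convex hull {u, v, w} \<subseteq> ?D" if "u \<in> ?D" "v \<in> ?D" "w \<in> ?D" for u v w
    by (rule hull_minimal) (use that in auto)
  have "triangle_integral \<omega> a b c = triangle_integral \<omega> a r q + triangle_integral \<omega> r b p +
      triangle_integral \<omega> q p c + triangle_integral \<omega> p q r"
    using line_integral_midpoint[OF cont[OF mem(1,2)], folded mid]
      line_integral_midpoint[OF cont[OF mem(2,3)], folded mid]
      line_integral_midpoint[OF cont[OF mem(3,1)], folded mid]
      line_integral_reverse[OF cont[OF mem'(1,2)]] line_integral_reverse[OF cont[OF mem'(2,3)]]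
      line_integral_reverse[OF cont[OF mem'(3,1)]]
    unfolding triangle_integral_def by simp
  then have "norm (triangle_integral \<omega> a b c) \<le> norm (triangle_integral \<omega> a r q) +
      norm (triangle_integral \<omega> r b p) + norm (triangle_integral \<omega> q p c) + norm (triangle_integral \<omega> p q r)"
    by (metis (no_types, lifting) norm_triangle_mono order_refl)
  then consider "norm (triangle_integral \<omega> a b c) \<le> 4 * norm (triangle_integral \<omega> a r q)"
    | "norm (triangle_integral \<omega> a b c) \<le> 4 * norm (triangle_integral \<omega> r b p)"
    | "norm (triangle_integral \<omega> a b c) \<le> 4 * norm (triangle_integral \<omega> q p c)"
    | "norm (triangle_integral \<omega> a b c) \<le> 4 * norm (triangle_integral \<omega> p q r)"
    by linarith
  note cases = this
  have half: "norm ((1/2) *\<^sub>R y) = norm y / 2" for y :: 'a by simp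
  have half_diff: "(1/2) *\<^sub>R y - y = - ((1/2) *\<^sub>R y)" for y :: 'a
  proof -
    have "(1/2) *\<^sub>R y - y = (1/2 - 1) *\<^sub>R y" by (simp only: scaleR_left_diff_distrib scaleR_one)
    then show ?thesis by simp
  qed
  have diffs: "r - a = (1/2) *\<^sub>R (b - a)" "b - r = (1/2) *\<^sub>R (b - a)" "p - b = (1/2) *\<^sub>R (c - b)"
    "c - p = (1/2) *\<^sub>R (c - b)" "q - c = (1/2) *\<^sub>R (a - c)" "a - q = (1/2) *\<^sub>R (a - c)"
    "q - r = (1/2) *\<^sub>R (c - b)" "r - p = (1/2) *\<^sub>R (a - c)" "p - q = (1/2) *\<^sub>R (b - a)"
    unfolding mid midpoint_def
    by (simp_all add: scaleR_diff_right scaleR_add_right eq_diff_eq diff_eq_eq half_diff flip: scaleR_2)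
  have diffs': "p - r = - (r - p)" "q - p = - (p - q)" "r - q = - (q - r)" by auto
  have per: "perimeter a r q = perimeter a b c / 2" "perimeter r b p = perimeter a b c / 2"
    "perimeter q p c = perimeter a b c / 2" "perimeter p q r = perimeter a b c / 2"
    unfolding perimeter_def diffs' norm_minus_cancel diffs half by simp_all
  show thesis
    by (rule cases; rule that[OF sub _]; (rule mem mem' per | assumption))
qed

text \<open>Goursat's argument: after \<open>n\<close> subdivisions the integral is at least \<open>\<eta> / 4\<^sup>n\<close>, while the
  linear part of \<open>\<omega>\<close> at the limit point contributes nothing (as \<open>A\<close> is symmetric) and the remainder
  at most \<open>\<epsilon> (K / 2\<^sup>n)\<^sup>2\<close>.\<close>

lemma triangle_integral_closed_form:
  fixes \<omega> :: "'a::euclidean_space \<Rightarrow> 'a \<Rightarrow>\<^sub>L 'b::banach"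
  assumes closed: "closed_form_on \<omega> (convex hull {a, b, c})"
  shows "triangle_integral \<omega> a b c = 0"
proof (rule ccontr)
  let ?D = "\<lambda>(a, b, c). convex hull {a, b, c :: 'a}"
  let ?T = "\<lambda>(a, b, c). triangle_integral \<omega> a b c"
  let ?p = "\<lambda>(a, b, c). perimeter a b c"
  define \<eta> K where "\<eta> = norm (?T (a, b, c))" "K = ?p (a, b, c)"
  assume "triangle_integral \<omega> a b c \<noteq> 0"
  then have \<eta>: "\<eta> > 0" by (simp add: \<eta>_K_def)
  let ?P = "\<lambda>n t. ?D t \<subseteq> ?D (a, b, c) \<and> ?p t = K / 2 ^ n \<and> \<eta> / 4 ^ n \<le> norm (?T t)"
  have "\<exists>t. \<forall>n. ?P n (t n) \<and> ?D (t (Suc n)) \<subseteq> ?D (t n)"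
  proof (rule dependent_nat_choice)
    show "\<exists>t. ?P 0 t" by (rule exI[of _ "(a, b, c)"]) (simp add: \<eta>_K_def)
  next
    fix t n assume P: "?P n t"
    obtain x y z where t: "t = (x, y, z)" by (cases t) auto
    have "continuous_on (convex hull {x, y, z}) \<omega>"
      using closed_form_on_imp_continuous_on[OF closed] continuous_on_subset P t by fastforce
    then obtain x' y' z' where *: "convex hull {x', y', z'} \<subseteq> convex hull {x, y, z}"
      "perimeter x' y' z' = perimeter x y z / 2"
      "norm (triangle_integral \<omega> x y z) \<le> 4 * norm (triangle_integral \<omega> x' y' z')"
      by (rule triangle_integral_subdivide)
    have "\<eta> / 4 ^ n \<le> 4 * norm (triangle_integral \<omega> x' y' z')"
      using P t *(3) by auto
    then have "\<eta> / 4 ^ Suc n \<le> norm (triangle_integral \<omega> x' y' z')"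
      by (simp add: field_simps)
    with P * t show "\<exists>t'. ?P (Suc n) t' \<and> ?D t' \<subseteq> ?D t"
      by (intro exI[of _ "(x', y', z')"]) auto
  qed
  then obtain t where t_nest: "\<forall>n. ?P n (t n) \<and> ?D (t (Suc n)) \<subseteq> ?D (t n)" by (rule exE)
  have t: "?P n (t n)" for n using spec[OF t_nest] by (rule conjunct1)
  have nest: "?D (t (Suc n)) \<subseteq> ?D (t n)" for n using spec[OF t_nest] by (rule conjunct2)
  \<comment> \<open>Nested nonempty compact sets have a common point; the derivative there controls
    the integrals over the small triangles.\<close>
  have "\<exists>x. \<forall>n. x \<in> ?D (t n)"
  proof (rule bounded_closed_nest[of "\<lambda>n. ?D (t n)"])
    show "closed (?D (t n))" for n
      by (auto split: prod.split intro: compact_imp_closed finite_imp_compact_convex_hull)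
    show "?D (t n) \<noteq> {}" for n
      by (auto split: prod.split)
    show "?D (t n) \<subseteq> ?D (t m)" if "m \<le> n" for m n
      using lift_Suc_antimono_le[of "\<lambda>n. ?D (t n)", OF nest that] .
    show "bounded (?D (t 0))"
      by (auto split: prod.split intro: compact_imp_bounded finite_imp_compact_convex_hull)
  qed blast
  then obtain x where x: "\<And>n. x \<in> ?D (t n)" by blast
  then have "x \<in> convex hull {a, b, c}" using subsetD[OF conjunct1[OF t] x] by simp
  then obtain A where A: "(\<omega> has_derivative A) (at x)" and sym: "\<And>u v. A u v = A v u"
    using closed unfolding closed_form_on_def by blast
  \<comment> \<open>The summand 1 keeps the denominator positive and lets the final bound
    \<open>\<eta> \<le> \<epsilon> * K\<^sup>2\<close> contradict
    \<open>\<epsilon> * (K\<^sup>2 + 1) = \<eta>\<close>.\<close>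
  define \<epsilon> where "\<epsilon> = \<eta> / (K\<^sup>2 + 1)"
  have K1: "K\<^sup>2 + 1 > 0" by (simp add: add_nonneg_pos)
  then have \<epsilon>: "\<epsilon> > 0" using \<eta> by (simp add: \<epsilon>_def)
  obtain d where d: "d > 0"
    "\<And>z. norm (z - x) < d \<Longrightarrow> norm (\<omega> z - \<omega> x - A (z - x)) \<le> \<epsilon> * norm (z - x)"
    using has_derivative_at_estimate[OF A \<epsilon>] by metis
  have "(\<lambda>n. K / 2 ^ n) \<longlonglongrightarrow> 0"
    using LIMSEQ_divide_realpow_zero[of 2 K] by simp
  then obtain n where n: "K / 2 ^ n < d"
    using d(1) by (metis eventually_happens order_tendstoD(2) trivial_limit_sequentially)
  obtain a' b' c' where abc: "t n = (a', b', c')" by (cases "t n") auto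
  note tn = t[of n, unfolded abc, simplified]
  have "norm (triangle_integral \<omega> a' b' c' - (1/2) *\<^sub>R (A (b' - a') (c' - a') - A (c' - a') (b' - a')))
      \<le> (\<epsilon> * (K / 2 ^ n)) * (norm (b' - a') + norm (c' - b') + norm (a' - c'))"
  proof (rule triangle_integral_linearization)
    show "continuous_on (convex hull {a', b', c'}) \<omega>"
      using closed_form_on_imp_continuous_on[OF closed] continuous_on_subset tn by blast
    show "bounded_linear A" using A by (rule has_derivative_bounded_linear)
    fix z assume z: "z \<in> convex hull {a', b', c'}"
    have le: "norm (z - x) \<le> K / 2 ^ n"
      using norm_diff_le_perimeter[OF z] x[of n] tn by (simp add: abc)
    then have "norm (\<omega> z - \<omega> x - A (z - x)) \<le> \<epsilon> * norm (z - x)"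
      using d(2) n by fastforce
    also have "\<dots> \<le> \<epsilon> * (K / 2 ^ n)" using le \<epsilon> by (intro mult_left_mono) auto
    finally show "norm (\<omega> z - \<omega> x - A (z - x)) \<le> \<epsilon> * (K / 2 ^ n)" .
  qed
  \<comment> \<open>One factor \<open>K / 2 ^ n\<close> bounds the distance to \<open>x\<close>, the
    other is the perimeter; together they match the lower bound's \<open>4 ^ n\<close>.\<close>
  then have "norm (triangle_integral \<omega> a' b' c') \<le> (\<epsilon> * (K / 2 ^ n)) * (K / 2 ^ n)"
    using sym[of "b' - a'" "c' - a'"] tn by (simp add: perimeter_def)
  with tn have "\<eta> / 4 ^ n \<le> (\<epsilon> * (K / 2 ^ n)) * (K / 2 ^ n)" by linarith
  also have "\<dots> = \<epsilon> * K\<^sup>2 / 4 ^ n"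
    by (simp add: power2_eq_square field_simps flip: power_mult_distrib)
  finally have "\<eta> \<le> \<epsilon> * K\<^sup>2" by (simp add: divide_le_cancel)
  moreover have "\<epsilon> * (K\<^sup>2 + 1) = \<eta>" using K1 by (simp add: \<epsilon>_def)
  ultimately show False using \<epsilon> by (simp add: algebra_simps)
qed

text \<open>The primitive is the integral along the segment from a fixed \<open>a\<close>. Vanishing
  triangle integrals turn its increments into integrals from \<open>x\<close> to \<open>y\<close>,
  and continuity of \<open>\<omega>\<close> at \<open>x\<close> yields the derivative.\<close>

lemma closed_form_convex_imp_exact:
  fixes \<omega> :: "'a::euclidean_space \<Rightarrow> 'a \<Rightarrow>\<^sub>L 'b::banach"
  assumes "open M" "convex M" and closed: "closed_form_on \<omega> M"
  shows "exact_form_on \<omega> M"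
proof (cases "M = {}")
  case True
  then show ?thesis by (simp add: exact_form_on_def)
next
  case False
  then obtain a where a: "a \<in> M" by blast
  note cont = closed_form_on_imp_continuous_on[OF closed]
  have contseg: "continuous_on (closed_segment p q) \<omega>" if "p \<in> M" "q \<in> M" for p q
    using cont continuous_on_subset closed_segment_subset[OF that \<open>convex M\<close>] by blast
  have diff: "line_integral \<omega> a y - line_integral \<omega> a x = line_integral \<omega> x y"
    if "x \<in> M" "y \<in> M" for x y
  proof -
    have "convex hull {a, x, y} \<subseteq> M"
      by (rule hull_minimal) (use that a \<open>convex M\<close> in auto)
    then have "triangle_integral \<omega> a x y = 0"
      by (intro triangle_integral_closed_form closed_form_on_subset[OF closed])
    with line_integral_reverse[OF contseg[OF a that(2)]] show ?thesis
      unfolding triangle_integral_def by (simp add: algebra_simps)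
  qed
  have "(line_integral \<omega> a has_derivative \<omega> x) (at x)" if x: "x \<in> M" for x
    unfolding has_derivative_at_alt
  proof (intro conjI allI impI)
    show "bounded_linear (\<omega> x)" by (rule blinfun.bounded_linear_right)
    fix e :: real assume e: "e > 0"
    have "isCont \<omega> x" using cont x \<open>open M\<close> continuous_on_eq_continuous_at by blast
    then obtain d where d: "d > 0" "\<And>z. dist z x < d \<Longrightarrow> dist (\<omega> z) (\<omega> x) < e"
      using e unfolding continuous_at_eps_delta by blast
    obtain r where r: "r > 0" "ball x r \<subseteq> M" using \<open>open M\<close> x openE by blast
    show "\<exists>d>0. \<forall>y. norm (y - x) < d \<longrightarrow>
        norm (line_integral \<omega> a y - line_integral \<omega> a x - \<omega> x (y - x)) \<le> e * norm (y - x)"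
    proof (intro exI[of _ "min d r"] conjI allI impI)
      show "min d r > 0" using d r by simp
      fix y assume y: "norm (y - x) < min d r"
      then have "y \<in> M" using r(2) by (auto simp: dist_norm norm_minus_commute)
      have "norm (line_integral \<omega> x y - (\<omega> x (y - x) + blinfun_apply 0 (y - x) +
          (1/2) *\<^sub>R blinfun_apply 0 (y - x))) \<le> e * norm (y - x)"
      \<comment> \<open>With \<open>A = 0\<close> the required estimate is just
        \<open>norm (\<omega> z - \<omega> x) \<le> e\<close>.\<close>
      proof (rule line_integral_linearization[where A = "\<lambda>_. 0"])
        fix z assume "z \<in> closed_segment x y"
        then have "norm (z - x) \<le> norm (y - x)"
          by (metis norm_minus_commute segment_bound1)
        then have "dist z x < d" using y by (simp add: dist_norm)
        then show "norm (\<omega> z - \<omega> x - 0) \<le> e" using d(2) by (force simp: dist_norm)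
      qed (use contseg x \<open>y \<in> M\<close> in auto)
      then show "norm (line_integral \<omega> a y - line_integral \<omega> a x - \<omega> x (y - x)) \<le> e * norm (y - x)"
        using diff[OF x \<open>y \<in> M\<close>] by simp
    qed
  qed
  then show ?thesis unfolding exact_form_on_def by blast
qed

subsection \<open>Pullback to the disc\<close>

text \<open>The product rule gives two terms: one is symmetric because \<open>\<omega>\<close> is
  closed, the other because the second derivative of \<open>f\<close> is symmetric.\<close>

lemma closed_form_on_pullback:
  fixes \<omega> :: "'a::banach \<Rightarrow> 'a \<Rightarrow>\<^sub>L 'b::real_normed_vector"
    and f' :: "'c::real_normed_vector \<Rightarrow> 'c \<Rightarrow>\<^sub>L 'a"
  assumes closed: "closed_form_on \<omega> M" and "open N" and sub: "f ` N \<subseteq> M"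
    and f: "\<And>w. w \<in> N \<Longrightarrow> (f has_derivative f' w) (at w)" and f': "f' differentiable_on N"
  shows "closed_form_on (\<lambda>w. \<omega> (f w) o\<^sub>L f' w) N"
  unfolding closed_form_on_def
proof
  fix w assume w: "w \<in> N"
  obtain A where A: "(\<omega> has_derivative A) (at (f w))" and symA: "\<And>u v. A u v = A v u"
    using closed sub w unfolding closed_form_on_def by blast
  have "f' differentiable (at w)"
    using f' w \<open>open N\<close> differentiable_on_eq_differentiable_at by blast
  then obtain B where B: "(f' has_derivative B) (at w)" by (auto simp: differentiable_def)
  have symB: "B u v = B v u" for u v
    using \<open>open N\<close> w f differentiable_imp_continuous_on[OF f'] B by (rule symmetric_second_derivative)
  have "((\<lambda>w. \<omega> (f w) o\<^sub>L f' w) has_derivative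
      (\<lambda>h. (\<omega> (f w) o\<^sub>L B h) + (A (f' w h) o\<^sub>L f' w))) (at w)"
    by (rule bounded_bilinear.FDERIV[OF bounded_bilinear_blinfun_compose _ B])
      (rule has_derivative_compose[OF f[OF w] A])
  moreover have "((\<omega> (f w) o\<^sub>L B u) + (A (f' w u) o\<^sub>L f' w)) v = ((\<omega> (f w) o\<^sub>L B v) + (A (f' w v) o\<^sub>L f' w)) u" for u v
    using symB[of u v] symA[of "f' w u" "f' w v"] by (simp add: blinfun.add_left)
  ultimately show "\<exists>A. ((\<lambda>w. \<omega> (f w) o\<^sub>L f' w) has_derivative A) (at w) \<and> (\<forall>u v. A u v = A v u)"
    by blast
qed

text \<open>If \<open>G\<close> is a primitive of the pullback, \<open>G\<close> composed with
  \<open>g\<close> is one of \<open>\<omega>\<close>: since \<open>f (g z) = z\<close> on the open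
  set \<open>M\<close>, the derivatives of \<open>f\<close> and \<open>g\<close> compose to the
  identity.\<close>

lemma exact_form_on_transport:
  fixes \<omega> :: "'a::banach \<Rightarrow> 'a \<Rightarrow>\<^sub>L 'b::real_normed_vector"
    and f' :: "'c::real_normed_vector \<Rightarrow> 'c \<Rightarrow>\<^sub>L 'a"
  assumes "open M" and fg: "\<And>z. z \<in> M \<Longrightarrow> g z \<in> N \<and> f (g z) = z"
    and f: "\<And>w. w \<in> N \<Longrightarrow> (f has_derivative f' w) (at w)"
    and g: "\<And>z. z \<in> M \<Longrightarrow> g differentiable (at z)"
    and exact: "exact_form_on (\<lambda>w. \<omega> (f w) o\<^sub>L f' w) N"
  shows "exact_form_on \<omega> M"
proof -
  obtain G where G: "\<And>w. w \<in> N \<Longrightarrow> (G has_derivative (\<omega> (f w) o\<^sub>L f' w)) (at w)"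
    using exact unfolding exact_form_on_def by blast
  have "((\<lambda>z. G (g z)) has_derivative \<omega> z) (at z)" if z: "z \<in> M" for z
  proof -
    obtain g' where g': "(g has_derivative g') (at z)" using g[OF z] by (auto simp: differentiable_def)
    have "((\<lambda>z. f (g z)) has_derivative (\<lambda>h. f' (g z) (g' h))) (at z)"
      using has_derivative_compose[OF g' f] fg z by blast
    moreover have "((\<lambda>z. f (g z)) has_derivative (\<lambda>h. h)) (at z)"
      by (rule has_derivative_transform_within_open[OF has_derivative_ident \<open>open M\<close> z]) (simp add: fg)
    ultimately have id: "(\<lambda>h. f' (g z) (g' h)) = (\<lambda>h. h)" by (rule has_derivative_unique)
    have "((\<lambda>z. G (g z)) has_derivative (\<lambda>h. (\<omega> (f (g z)) o\<^sub>L f' (g z)) (g' h))) (at z)"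
      using has_derivative_compose[OF g' G] fg z by blast
    then show ?thesis using fun_cong[OF id] fg[OF z] by simp
  qed
  then show ?thesis unfolding exact_form_on_def by blast
qed

text \<open>A nonempty \<open>M\<close> is the whole plane or biholomorphic to the unit disc, and
  both of these are convex.\<close>

lemma closed_form_simply_connected_complex_imp_exact:
  fixes \<omega> :: "complex \<Rightarrow> complex \<Rightarrow>\<^sub>L 'b::banach"
  assumes "open M" "simply_connected M" and closed: "closed_form_on \<omega> M"
  shows "exact_form_on \<omega> M"
proof -
  consider "M = {}" | "M = UNIV" | f g where "f holomorphic_on M" "g holomorphic_on ball 0 1"
      "\<And>z. z \<in> M \<Longrightarrow> f z \<in> ball 0 1 \<and> g (f z) = z"
      "\<And>z. z \<in> ball 0 1 \<Longrightarrow> g z \<in> M \<and> f (g z) = z"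
    using Riemann_mapping_theorem[of M] assms(1,2) by metis
  then show ?thesis
  proof cases
    case 1
    then show ?thesis by (simp add: exact_form_on_def)
  next
    case 2
    then show ?thesis using closed_form_convex_imp_exact[of M] closed by simp
  next
    case (3 f g)
    let ?g' = "\<lambda>w. blinfun_mult_right (deriv g w)"
    have g: "(g has_derivative ?g' w) (at w)" if "w \<in> ball 0 1" for w
      using holomorphic_derivI[OF 3(2) open_ball that] by (simp add: has_field_derivative_def)
    \<comment> \<open>\<open>deriv g\<close> is itself holomorphic, so \<open>g\<close> is twice
      differentiable also in the real sense, as the pullback requires.\<close>
    have "?g' differentiable (at w)" if "w \<in> ball 0 1" for w
    proof -
      have "deriv g holomorphic_on ball 0 1" using 3(2) open_ball by (rule holomorphic_deriv)
      from holomorphic_derivI[OF this open_ball that]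
      have "(deriv g has_derivative (*) (deriv (deriv g) w)) (at w)"
        by (simp add: has_field_derivative_def)
      from bounded_linear.has_derivative[OF bounded_linear_blinfun_mult_right this]
      show ?thesis by (rule differentiableI)
    qed
    then have g': "?g' differentiable_on ball 0 1" by (rule differentiable_at_imp_differentiable_on)
    have f: "f differentiable (at z)" if "z \<in> M" for z
      using holomorphic_on_imp_differentiable_at[OF 3(1) \<open>open M\<close> that]
        field_differentiable_imp_differentiable by blast
    have "closed_form_on (\<lambda>w. \<omega> (g w) o\<^sub>L ?g' w) (ball 0 1)"
      by (rule closed_form_on_pullback[OF closed open_ball _ g g']) (use 3(4) in auto)
    then have exact: "exact_form_on (\<lambda>w. \<omega> (g w) o\<^sub>L ?g' w) (ball 0 1)"
      by (intro closed_form_convex_imp_exact) auto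
    show ?thesis
      by (rule exact_form_on_transport[OF \<open>open M\<close> 3(3) g f exact])
  qed
qed

text \<open>The plane is identified with the complex numbers by a linear map; its derivative is
  constant, so the same pullback and transport apply.\<close>

lemma closed_form_simply_connected_plane_imp_exact:
  fixes \<omega> :: "real \<times> real \<Rightarrow> (real \<times> real) \<Rightarrow>\<^sub>L 'b::banach"
  assumes "open M" "simply_connected M" and closed: "closed_form_on \<omega> M"
  shows "exact_form_on \<omega> M"
proof -
  define f where "f = (\<lambda>w. (Re w, Im w))"
  define g where "g = (\<lambda>z. Complex (fst z) (snd z))"
  define N where "N = g ` M"
  have f_lin: "bounded_linear f" unfolding f_def by (intro bounded_linear_intros bounded_linear_Re bounded_linear_Im)
  have g_eq: "g = (\<lambda>z. of_real (fst z) + \<i> * of_real (snd z))" by (simp add: g_def Complex_eq)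
  have g_lin: "bounded_linear g" unfolding g_eq
    by (intro bounded_linear_intros bounded_linear_compose[OF bounded_linear_of_real])
  have fg: "f (g z) = z" and gf: "g (f w) = w" for z w by (simp_all add: f_def g_def)
  have N: "N = f -` M"
  proof
    show "N \<subseteq> f -` M" by (auto simp: N_def fg)
    show "f -` M \<subseteq> N" unfolding N_def by (metis gf image_eqI subsetI vimageD)
  qed
  have "open N" unfolding N
    by (intro open_vimage \<open>open M\<close> linear_continuous_on f_lin)
  have "homeomorphism M N g f"
    unfolding homeomorphism_def N_def
    by (auto simp: fg gf linear_continuous_on f_lin g_lin image_image)
  then have "simply_connected N"
    using assms(2) homeomorphic_simply_connected_eq homeomorphic_def by blast
  have f: "(f has_derivative Blinfun f) (at w)" for w
    by (simp add: bounded_linear_Blinfun_apply f_lin bounded_linear_imp_has_derivative)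
  have "closed_form_on (\<lambda>w. \<omega> (f w) o\<^sub>L Blinfun f) N"
    by (rule closed_form_on_pullback[OF closed \<open>open N\<close> _ f]) (auto simp: N)
  then have exact: "exact_form_on (\<lambda>w. \<omega> (f w) o\<^sub>L Blinfun f) N"
    by (rule closed_form_simply_connected_complex_imp_exact[OF \<open>open N\<close> \<open>simply_connected N\<close>])
  show ?thesis
    by (rule exact_form_on_transport[OF \<open>open M\<close> _ f _ exact])
      (auto simp: N_def fg bounded_linear_imp_differentiable g_lin)
qed

subsection \<open>The form of a displacement field\<close>

text \<open>Frechet differentiability makes the slice differentiable, so the total function
  \<open>deriv\<close> returns a genuine derivative here.\<close>

lemma partial_q_has_derivative:
  assumes "(f has_derivative D) (at z)"
  shows "partial_q f z = D (1, 0)"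
proof -
  obtain q p where z: "z = (q, p)" by (cases z)
  have "((\<lambda>x. (x, p)) has_derivative (\<lambda>h. (h, 0))) (at q)" by (auto intro!: derivative_eq_intros)
  then have *: "((\<lambda>x. f (x, p)) has_derivative (\<lambda>h. D (h, 0))) (at q)"
    by (rule has_derivative_compose) (use assms z in simp)
  interpret D: bounded_linear D using assms by (rule has_derivative_bounded_linear)
  have "(\<lambda>h. D (h, 0)) = (*) (D (1, 0))"
  proof
    show "D (h, 0) = D (1, 0) * h" for h using D.scaleR[of h "(1, 0)"] by simp
  qed
  with * have "((\<lambda>x. f (x, p)) has_field_derivative D (1, 0)) (at q)"
    by (simp only: has_field_derivative_def)
  then show ?thesis unfolding z partial_q_def by (simp add: DERIV_imp_deriv)
qed

lemma partial_p_has_derivative: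
  assumes "(f has_derivative D) (at z)"
  shows "partial_p f z = D (0, 1)"
proof -
  obtain q p where z: "z = (q, p)" by (cases z)
  have "((\<lambda>y. (q, y)) has_derivative (\<lambda>h. (0, h))) (at p)" by (auto intro!: derivative_eq_intros)
  then have *: "((\<lambda>y. f (q, y)) has_derivative (\<lambda>h. D (0, h))) (at p)"
    by (rule has_derivative_compose) (use assms z in simp)
  interpret D: bounded_linear D using assms by (rule has_derivative_bounded_linear)
  have "(\<lambda>h. D (0, h)) = (*) (D (0, 1))"
  proof
    show "D (0, h) = D (0, 1) * h" for h using D.scaleR[of h "(0, 1)"] by simp
  qed
  with * have "((\<lambda>y. f (q, y)) has_field_derivative D (0, 1)) (at p)"
    by (simp only: has_field_derivative_def)
  then show ?thesis unfolding z partial_p_def by (simp add: DERIV_imp_deriv)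
qed

text \<open>With \<open>A\<close> the second derivative of \<open>H\<close>, the divergence is
  \<open>A (1, 0) (0, 1) - A (0, 1) (1, 0)\<close>.\<close>

lemma follows_hamilton_equations_imp_divergenceless:
  assumes "open M" "follows_hamilton_equations M S"
  shows "divergenceless M S"
  unfolding divergenceless_def
proof
  fix z assume z: "z \<in> M"
  obtain H f' where f': "\<And>z. z \<in> M \<Longrightarrow> (H has_derivative blinfun_apply (f' z)) (at z)"
    "f' differentiable_on M"
    and S: "\<And>z. z \<in> M \<Longrightarrow> fst (S z) = partial_p H z \<and> snd (S z) = - partial_q H z"
    using assms(2) unfolding follows_hamilton_equations_def twice_differentiable_on_def by blast
  have "f' differentiable (at z)"
    using f'(2) z \<open>open M\<close> differentiable_on_eq_differentiable_at by blast
  then obtain A where A: "(f' has_derivative A) (at z)" by (auto simp: differentiable_def)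
  have sym: "A u v = A v u" for u v
    using \<open>open M\<close> z f'(1) differentiable_imp_continuous_on[OF f'(2)] A by (rule symmetric_second_derivative)
  have eval_deriv: "((\<lambda>w. f' w v) has_derivative (\<lambda>h. A h v)) (at z)" for v
    by (rule bounded_linear.has_derivative[OF blinfun.bounded_linear_left A])
  \<comment> \<open>Hamilton's equations hold on an open set around \<open>z\<close>, so they may be
    differentiated at \<open>z\<close>.\<close>
  have "((\<lambda>w. fst (S w)) has_derivative (\<lambda>h. A h (0, 1))) (at z)"
    by (rule has_derivative_transform_within_open[OF eval_deriv \<open>open M\<close> z])
      (simp add: S partial_p_has_derivative[OF f'(1)])
  moreover have "((\<lambda>w. snd (S w)) has_derivative (\<lambda>h. - A h (1, 0))) (at z)"
    by (rule has_derivative_transform_within_open[OF has_derivative_minus[OF eval_deriv] \<open>open M\<close> z])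
      (simp add: S partial_q_has_derivative[OF f'(1)])
  ultimately show "partial_q (\<lambda>w. fst (S w)) z + partial_p (\<lambda>w. snd (S w)) z = 0"
    using sym[of "(1, 0)" "(0, 1)"] by (simp add: partial_q_has_derivative partial_p_has_derivative)
qed

text \<open>\<open>Blinfun fst\<close> is dq and \<open>Blinfun snd\<close> is dp; the form is the
  contraction of the area form dq \<and> dp with \<open>S\<close>.\<close>

definition hamiltonian_form :: "(real \<times> real \<Rightarrow> real \<times> real) \<Rightarrow> real \<times> real \<Rightarrow> (real \<times> real) \<Rightarrow>\<^sub>L real" where
  "hamiltonian_form S z = fst (S z) *\<^sub>R Blinfun snd - snd (S z) *\<^sub>R Blinfun fst"

lemma hamiltonian_form_apply [simp]:
  "hamiltonian_form S z v = fst (S z) * snd v - snd (S z) * fst v"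
  by (simp add: hamiltonian_form_def blinfun.diff_left blinfun.scaleR_left
      bounded_linear_Blinfun_apply bounded_linear_fst bounded_linear_snd)

lemma has_derivative_hamiltonian_form:
  assumes "(S has_derivative D) (at z)"
  shows "(hamiltonian_form S has_derivative
    (\<lambda>u. fst (D u) *\<^sub>R Blinfun snd - snd (D u) *\<^sub>R Blinfun fst)) (at z)"
proof -
  have "hamiltonian_form S = (\<lambda>z. fst (S z) *\<^sub>R Blinfun snd - snd (S z) *\<^sub>R Blinfun fst)"
    by (simp add: fun_eq_iff hamiltonian_form_def)
  then show ?thesis
    using has_derivative_diff[OF has_derivative_scaleR_left[OF has_derivative_fst[OF assms]]
        has_derivative_scaleR_left[OF has_derivative_snd[OF assms]]] by simp
qed

text \<open>The antisymmetric part of the derivative of the form is the divergence of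
  \<open>S\<close> times the area form.\<close>

lemma closed_hamiltonian_form:
  assumes "open M" "S differentiable_on M" "divergenceless M S"
  shows "closed_form_on (hamiltonian_form S) M"
  unfolding closed_form_on_def
proof
  fix z assume z: "z \<in> M"
  have "S differentiable (at z)"
    using assms(1,2) z differentiable_on_eq_differentiable_at by blast
  then obtain D where D: "(S has_derivative D) (at z)" by (auto simp: differentiable_def)
  interpret D: bounded_linear D using D by (rule has_derivative_bounded_linear)
  have div: "fst (D (1, 0)) + snd (D (0, 1)) = 0"
    using bspec[OF assms(3)[unfolded divergenceless_def] z] partial_q_has_derivative[OF has_derivative_fst[OF D]]
      partial_p_has_derivative[OF has_derivative_snd[OF D]]
    by simp
  have D_eq: "D u = fst u *\<^sub>R D (1, 0) + snd u *\<^sub>R D (0, 1)" for u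
    by (simp flip: D.add D.scaleR)
  let ?A = "\<lambda>u. fst (D u) *\<^sub>R Blinfun snd - snd (D u) *\<^sub>R Blinfun fst"
  have A: "?A u v = fst (D u) * snd v - snd (D u) * fst v" for u v
    by (simp add: blinfun.diff_left blinfun.scaleR_left
      bounded_linear_Blinfun_apply bounded_linear_fst bounded_linear_snd)
  have "?A u v - ?A v u = (fst (D (1, 0)) + snd (D (0, 1))) * (fst u * snd v - fst v * snd u)" for u v
    unfolding A by (subst (1 2 3 4) D_eq) (simp add: algebra_simps)
  then have "?A u v = ?A v u" for u v unfolding div by simp
  with has_derivative_hamiltonian_form[OF D]
  show "\<exists>A. (hamiltonian_form S has_derivative A) (at z) \<and> (\<forall>u v. A u v = A v u)"
    by blast
qed

text \<open>Simple connectedness makes \<open>H\<close> global: on the punctured plane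
  \<open>(q, p) / (q\<^sup>2 + p\<^sup>2)\<close> is divergenceless, but its form is the angle form,
  which has no primitive.\<close>

theorem proposition1:
  fixes M :: "(real \<times> real) set"
    and S :: "real \<times> real \<Rightarrow> real \<times> real"
  assumes "open M" and "simply_connected M"
    and "S differentiable_on M"
  shows "follows_hamilton_equations M S \<longleftrightarrow> divergenceless M S"
proof
  assume "follows_hamilton_equations M S"
  with \<open>open M\<close> show "divergenceless M S" by (rule follows_hamilton_equations_imp_divergenceless)
next
  assume "divergenceless M S"
  with assms have closed: "closed_form_on (hamiltonian_form S) M" by (intro closed_hamiltonian_form)
  then obtain H where H: "\<And>z. z \<in> M \<Longrightarrow> (H has_derivative hamiltonian_form S z) (at z)"
    using closed_form_simply_connected_plane_imp_exact[OF assms(1,2)] unfolding exact_form_on_def by blast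
  \<comment> \<open>The form is itself the derivative of \<open>H\<close>, so its differentiability
    makes \<open>H\<close> twice differentiable.\<close>
  have "hamiltonian_form S differentiable_on M"
    by (rule differentiable_at_imp_differentiable_on)
      (use closed in \<open>auto simp: closed_form_on_def differentiable_def\<close>)
  then have "twice_differentiable_on H M"
    unfolding twice_differentiable_on_def using H by blast
  moreover have "fst (S z) = partial_p H z \<and> snd (S z) = - partial_q H z" if "z \<in> M" for z
    by (simp add: partial_p_has_derivative[OF H[OF that]] partial_q_has_derivative[OF H[OF that]])
  ultimately show "follows_hamilton_equations M S"
    unfolding follows_hamilton_equations_def by blast
qed

end
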